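(* Let $(S,\bullet)$ be a right adequate partial semigroup and let $A\subseteq S$. (a) $A$ is partially thick if and only if $S\setminus A$ is not partially syndetic. (b) $A$ is partially syndetic if and only if $S\setminus A$ is not partially thick.
   Context: A partial semigroup is a nonempty set $S$ with a partially defined operation $\bullet$ such that $(x\bullet y)\bullet z=x\bullet(y\bullet z)$ in the sense that if either side is defined so is the other and they are equal. $R(x)=\{s:x\bullet s\text{ defined}\}$, $R(H)=\bigcap_{s\in H}R(s)$; $S$ is right adequate if $R(H)\ne\emptyset$ for every finite nonempty $H\subseteq S$. $\beta S$ is the set of ultrafilters on $S$; for $p\in\beta S$, $L(p)=\{s\in S:R(s)\in p\}$; $\mathcal P_f(Y)$ is the set of finite nonempty subsets of $Y$; $s^{-1}A=\{t\in R(s):s\bullet t\in A\}$; $F\bullet t=\{s\bullet t:s\in F\}$. $A$ is partially syndetic if for every $p\in\beta S$ there is $H\in\mathcal P_f(L(p))$ with $R(H)\subseteq\bigcup_{t\in H}t^{-1}A$. $A$ is partially thick if there exists $p\in\beta S$ such that for every $F\in\mathcal P_f(L(p))$ there exists $t\in R(F)$ with $F\bullet t\subseteq A$. *)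

theory Defs
  imports Main
begin

text \<open>A partial operation on a carrier \<open>S\<close> is a function into \<open>option\<close>, with \<open>None\<close> for undefined.
  In the associativity law, equality in \<open>option\<close> says that one side is defined iff
  the other is, and that the values then agree.\<close>

definition partial_semigroup :: "'a set \<Rightarrow> ('a \<Rightarrow> 'a \<Rightarrow> 'a option) \<Rightarrow> bool" where
  "partial_semigroup S m \<longleftrightarrow>
     S \<noteq> {} \<and>
     (\<forall>x\<in>S. \<forall>y\<in>S. \<forall>z. m x y = Some z \<longrightarrow> z \<in> S) \<and>
     (\<forall>x\<in>S. \<forall>y\<in>S. \<forall>z\<in>S.
        Option.bind (m x y) (\<lambda>u. m u z) = Option.bind (m y z) (\<lambda>v. m x v))"

definition R_elem :: "'a set \<Rightarrow> ('a \<Rightarrow> 'a \<Rightarrow> 'a option) \<Rightarrow> 'a \<Rightarrow> 'a set" where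
  "R_elem S m x = {s \<in> S. m x s \<noteq> None}"

text \<open>\<open>R(H)\<close>; only meaningful for nonempty \<open>H\<close>, since the empty intersection is \<open>UNIV\<close>.\<close>

definition R_set :: "'a set \<Rightarrow> ('a \<Rightarrow> 'a \<Rightarrow> 'a option) \<Rightarrow> 'a set \<Rightarrow> 'a set" where
  "R_set S m H = (\<Inter>s\<in>H. R_elem S m s)"

definition Pf :: "'a set \<Rightarrow> 'a set set" where
  "Pf Y = {H. finite H \<and> H \<noteq> {} \<and> H \<subseteq> Y}"

definition right_adequate :: "'a set \<Rightarrow> ('a \<Rightarrow> 'a \<Rightarrow> 'a option) \<Rightarrow> bool" where
  "right_adequate S m \<longleftrightarrow> (\<forall>H\<in>Pf S. R_set S m H \<noteq> {})"

definition ultrafilter_on :: "'a set \<Rightarrow> 'a set set \<Rightarrow> bool" where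
  "ultrafilter_on S p \<longleftrightarrow>
     p \<subseteq> Pow S \<and> S \<in> p \<and> {} \<notin> p \<and>
     (\<forall>A\<in>p. \<forall>B\<in>p. A \<inter> B \<in> p) \<and>
     (\<forall>A\<in>p. \<forall>B. A \<subseteq> B \<and> B \<subseteq> S \<longrightarrow> B \<in> p) \<and>
     (\<forall>A. A \<subseteq> S \<longrightarrow> A \<in> p \<or> S - A \<in> p)"

definition beta :: "'a set \<Rightarrow> 'a set set set" where
  "beta S = {p. ultrafilter_on S p}"

definition L_uf :: "'a set \<Rightarrow> ('a \<Rightarrow> 'a \<Rightarrow> 'a option) \<Rightarrow> 'a set set \<Rightarrow> 'a set" where
  "L_uf S m p = {s \<in> S. R_elem S m s \<in> p}"

text \<open>\<open>s\<^sup>-\<^sup>1A\<close>\<close>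

definition inv_translate ::
  "'a set \<Rightarrow> ('a \<Rightarrow> 'a \<Rightarrow> 'a option) \<Rightarrow> 'a \<Rightarrow> 'a set \<Rightarrow> 'a set" where
  "inv_translate S m s A = {t \<in> R_elem S m s. the (m s t) \<in> A}"

text \<open>\<open>F \<bullet> t\<close>; used for \<open>t \<in> R(F)\<close>, where every product \<open>s \<bullet> t\<close> with \<open>s \<in> F\<close> is defined.\<close>

definition right_translate ::
  "('a \<Rightarrow> 'a \<Rightarrow> 'a option) \<Rightarrow> 'a set \<Rightarrow> 'a \<Rightarrow> 'a set" where
  "right_translate m F t = {the (m s t) | s. s \<in> F}"

definition partially_syndetic ::
  "'a set \<Rightarrow> ('a \<Rightarrow> 'a \<Rightarrow> 'a option) \<Rightarrow> 'a set \<Rightarrow> bool" where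
  "partially_syndetic S m A \<longleftrightarrow>
     (\<forall>p\<in>beta S. \<exists>H\<in>Pf (L_uf S m p). R_set S m H \<subseteq> (\<Union>t\<in>H. inv_translate S m t A))"

definition partially_thick ::
  "'a set \<Rightarrow> ('a \<Rightarrow> 'a \<Rightarrow> 'a option) \<Rightarrow> 'a set \<Rightarrow> bool" where
  "partially_thick S m A \<longleftrightarrow>
     (\<exists>p\<in>beta S. \<forall>F\<in>Pf (L_uf S m p). \<exists>t\<in>R_set S m F. right_translate m F t \<subseteq> A)"

end

theory Submission
  imports Defs
begin

text \<open>Thickness and syndeticity are dual under complement by negation of quantifiers. For F in
  P_f(L(p)), a point t of R(F) satisfies F t \<subseteq> A exactly when t lies in no s^{-1}(S - A)
  with s in F (\<open>right_translate_subset_iff\<close>). So a suitable t exists iff these sets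
  fail to cover R(F). Negating over F and p gives (a); (b) is (a) applied to S - A.\<close>

lemma right_translate_subset_iff:
  assumes "partial_semigroup S m" and "F \<in> Pf S" and "t \<in> R_set S m F"
  shows "right_translate m F t \<subseteq> A \<longleftrightarrow> t \<notin> (\<Union>s\<in>F. inv_translate S m s (S - A))"
proof -
  have R: "t \<in> R_elem S m s" if "s \<in> F" for s
    using assms(3) that by (auto simp: R_set_def)
  have closed: "\<forall>x\<in>S. \<forall>y\<in>S. \<forall>z. m x y = Some z \<longrightarrow> z \<in> S"
    using assms(1) unfolding partial_semigroup_def by (elim conjE)
  \<comment> \<open>Products must lie in S: only there does avoiding S - A mean belonging to
    A.\<close>
  have "the (m s t) \<in> S" if "s \<in> F" for s
  proof -
    have "s \<in> S" using assms(2) that by (auto simp: Pf_def)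
    moreover from R[OF that] obtain u where "t \<in> S" "m s t = Some u"
      by (auto simp: R_elem_def)
    ultimately have "u \<in> S" using closed by blast
    with \<open>m s t = Some u\<close> show ?thesis by simp
  qed
  with R show ?thesis
    by (auto simp: right_translate_def inv_translate_def)
qed

lemma partially_thick_iff_not_syndetic_compl:
  assumes "partial_semigroup S m"
  shows "partially_thick S m A \<longleftrightarrow> \<not> partially_syndetic S m (S - A)"
proof -
  have "(\<exists>t\<in>R_set S m F. right_translate m F t \<subseteq> A) \<longleftrightarrow>
        \<not> R_set S m F \<subseteq> (\<Union>s\<in>F. inv_translate S m s (S - A))" (is "?T F \<longleftrightarrow> \<not> ?C F")
    if "F \<in> Pf (L_uf S m p)" for p F
  proof -
    have "F \<in> Pf S"
      using that by (auto simp: Pf_def L_uf_def)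
    from right_translate_subset_iff[OF assms this] show ?thesis
      by blast
  qed
  \<comment> \<open>De Morgan over F with p fixed; the quantifier over p is negated
    afterwards.\<close>
  then have "(\<forall>F\<in>Pf (L_uf S m p). ?T F) \<longleftrightarrow> \<not> (\<exists>F\<in>Pf (L_uf S m p). ?C F)" for p
    by meson
  then show ?thesis
    unfolding partially_thick_def partially_syndetic_def by meson
qed

theorem theorem2p20:
  fixes S :: "'a set" and m :: "'a \<Rightarrow> 'a \<Rightarrow> 'a option" and A :: "'a set"
  assumes "partial_semigroup S m" and "right_adequate S m" and "A \<subseteq> S"
  shows "(partially_thick S m A \<longleftrightarrow> \<not> partially_syndetic S m (S - A)) \<and>
         (partially_syndetic S m A \<longleftrightarrow> \<not> partially_thick S m (S - A))"
  \<comment> \<open>The second instance yields (b), since A \<subseteq> S gives S - (S - A) =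
    A.\<close>
  using partially_thick_iff_not_syndetic_compl[OF assms(1), of A]
    partially_thick_iff_not_syndetic_compl
      [OF assms(1), of "S - A", unfolded double_diff[OF assms(3) order_refl]]
  by blast

end
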